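(* Let $D\subset\mathbb C^n$ be a domain with the following property: for every boundary point $a\in\partial D$ there are a neighborhood $U_a$ of $a$ and a plurisubharmonic function $u_a$ on $D\cap U_a$ such that $\lim_{D\cap U_a\ni z\to a}u_a(z)=\infty$. Then $D$ is pseudoconvex.
   Context: A domain is a connected open set. No boundedness or boundary regularity of $D$ is assumed. *)

theory Defs
  imports "HOL-Analysis.Analysis"
begin

definition usc_on :: "'a::topological_space set \<Rightarrow> ('a \<Rightarrow> ereal) \<Rightarrow> bool" where
  "usc_on S u \<longleftrightarrow> (\<forall>x\<in>S. \<forall>c. u x < c \<longrightarrow> (\<forall>\<^sub>F y in at x within S. u y < c))"

(* (1/2 pi) times the Lebesgue integral of u (z + r e^(i t)) over [0, 2 pi], as the integral of the
   positive part minus that of the negative part (e2ennreal sends negative numbers to 0). For a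
   function that is upper semicontinuous and < \<infinity> on the circle the first integral is finite, so the
   difference is meaningful; its value may be -\<infinity>. *)
definition circle_mean :: "(complex \<Rightarrow> ereal) \<Rightarrow> complex \<Rightarrow> real \<Rightarrow> ereal" where
  "circle_mean u z r =
     (enn2ereal (\<integral>\<^sup>+t\<in>{0..2*pi}. e2ennreal (u (z + of_real r * cis t)) \<partial>lborel)
      - enn2ereal (\<integral>\<^sup>+t\<in>{0..2*pi}. e2ennreal (- u (z + of_real r * cis t)) \<partial>lborel))
     / ereal (2 * pi)"

(* Values in [-\<infinity>, \<infinity>); the constant -\<infinity> is allowed. *)
definition subharmonic_on :: "complex set \<Rightarrow> (complex \<Rightarrow> ereal) \<Rightarrow> bool" where
  "subharmonic_on S u \<longleftrightarrow>
     open S \<and> (\<forall>z\<in>S. u z < \<infinity>) \<and> usc_on S u \<and>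
     (\<forall>z r. 0 < r \<and> cball z r \<subseteq> S \<longrightarrow> u z \<le> circle_mean u z r)"

definition plurisubharmonic_on :: "(complex ^ 'n) set \<Rightarrow> (complex ^ 'n \<Rightarrow> ereal) \<Rightarrow> bool" where
  "plurisubharmonic_on S u \<longleftrightarrow>
     open S \<and> (\<forall>z\<in>S. u z < \<infinity>) \<and> usc_on S u \<and>
     (\<forall>z w. subharmonic_on {\<tau>. z + \<tau> *s w \<in> S} (\<lambda>\<tau>. u (z + \<tau> *s w)))"

(* Existence of a continuous plurisubharmonic exhaustion function. *)
definition pseudoconvex :: "(complex ^ 'n) set \<Rightarrow> bool" where
  "pseudoconvex D \<longleftrightarrow>
     (\<exists>u :: complex ^ 'n \<Rightarrow> real.
        continuous_on D u \<and> plurisubharmonic_on D (\<lambda>z. ereal (u z)) \<and>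
        (\<forall>c. compact (closure {z\<in>D. u z < c}) \<and> closure {z\<in>D. u z < c} \<subseteq> D))"

end

theory Submission
  imports Defs "HOL-Complex_Analysis.Cauchy_Integral_Formula"
begin

text \<open>
  If \<open>D\<close> is the whole space, the norm is a plurisubharmonic exhaustion function.
  Otherwise let \<open>\<delta>(z)\<close> be the distance from \<open>z\<close> to the complement
  of \<open>D\<close>; then \<open>max (- ln \<delta>(z)) (norm z)\<close> is continuous, and its
  sublevel sets are bounded and stay away from the complement. Everything rests on the
  plurisubharmonicity of \<open>- ln \<delta>\<close>, lemma
  \<open>neg_ln_infdist_dominated\<close>.

  Suppose that \<open>- ln \<delta>\<close> violates the mean value inequality on a disc in a
  complex line. A trigonometric polynomial close to its values on the circle extends to the real
  part of a holomorphic function, and shifting that function until it touches, with a quadratic term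
  to spare, gives a holomorphic \<open>P\<close> and a point \<open>x\<close> of the disc with
  \<open>- ln \<delta> \<le> Re P(\<tau>) - \<epsilon> |\<tau> - x|^2\<close> on the disc, with
  equality at \<open>x\<close>. Let \<open>a\<close> be a point of the complement nearest to the
  point of the line at \<open>x\<close>, and \<open>v\<close> the unit vector for which moving that
  point by \<open>exp (- P(x)) v\<close> reaches \<open>a\<close>. The holomorphic discs obtained
  from the line by adding \<open>t exp (- P(\<tau>)) v\<close> then lie in \<open>D\<close> for
  \<open>0 \<le> t < 1\<close>, and the disc for \<open>t = 1\<close> leaves \<open>D\<close> at the
  single point \<open>a\<close>. The spare quadratic term is what makes the contact point unique:
  cut down to a small closed disc about \<open>x\<close>, the discs with \<open>t\<close> near
  \<open>1\<close> have their boundaries in a fixed compact subset of the part of \<open>D\<close>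
  on which the local function \<open>u\<close> at \<open>a\<close> is given, so \<open>u\<close> is
  bounded above there. The maximum principle along the discs bounds \<open>u\<close> at their
  centres, which tend to \<open>a\<close>, and this contradicts \<open>u \<rightarrow>
  \<infinity>\<close>.

  These discs are curved, whereas plurisubharmonicity speaks of complex lines only. Instead of
  regularising \<open>u\<close> to prove that it is subharmonic along every holomorphic disc, lemma
  \<open>plurisubharmonic_on_disc_max_principle\<close> maximises \<open>u\<close> with a penalty
  for the distance to the disc: at a maximum point the mean value inequality already fails in the
  tangent direction of the disc, since the Levi form of the square of the absolute value of a
  holomorphic function vanishes in every direction in which the derivative of that function is zero.
\<close>

section \<open>Upper semicontinuous functions\<close>

lemma usc_on_continuous:
  assumes "continuous_on S (f :: _ \<Rightarrow> real)"
  shows "usc_on S (\<lambda>x. ereal (f x))"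
proof -
  have "continuous_on S (\<lambda>x. ereal (f x))"
    using assms by (intro continuous_intros)
  then show ?thesis
    unfolding usc_on_def continuous_on_def by (blast dest: order_tendstoD(2))
qed

lemma usc_on_iff_openin:
  "usc_on S u \<longleftrightarrow> (\<forall>c. openin (top_of_set S) {x\<in>S. u x < c})"
proof
  assume u: "usc_on S u"
  show "\<forall>c. openin (top_of_set S) {x\<in>S. u x < c}"
  proof (intro allI, subst openin_subopen, clarsimp)
    fix c x assume x: "x \<in> S" "u x < c"
    then obtain V where V: "open V" "x \<in> V" "\<And>y. y \<in> V \<Longrightarrow> y \<noteq> x \<Longrightarrow> y \<in> S \<Longrightarrow> u y < c"
      using u unfolding usc_on_def eventually_at_topological by metis
    show "\<exists>T. openin (top_of_set S) T \<and> x \<in> T \<and> T \<subseteq> {x \<in> S. u x < c}"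
      using V x by (intro exI[of _ "S \<inter> V"]) (auto simp: openin_open)
  qed
next
  assume op: "\<forall>c. openin (top_of_set S) {x\<in>S. u x < c}"
  show "usc_on S u"
    unfolding usc_on_def
  proof (intro ballI allI impI)
    fix x c assume x: "x \<in> S" "u x < c"
    obtain V where V: "open V" "{x\<in>S. u x < c} = S \<inter> V"
      using op unfolding openin_open by metis
    then have "x \<in> V" and "\<forall>y\<in>V. y \<noteq> x \<longrightarrow> y \<in> S \<longrightarrow> u y < c"
      using x by auto
    with V(1) show "\<forall>\<^sub>F y in at x within S. u y < c"
      unfolding eventually_at_topological by blast
  qed
qed

lemma usc_on_compose:
  assumes "usc_on S u" "continuous_on T f" "f \<in> T \<rightarrow> S"
  shows "usc_on T (\<lambda>x. u (f x))"
  unfolding usc_on_iff_openin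
proof
  fix c
  have "openin (top_of_set T) (T \<inter> f -` {x\<in>S. u x < c})"
    using assms by (intro continuous_openin_preimage) (auto simp: usc_on_iff_openin)
  moreover have "T \<inter> f -` {x\<in>S. u x < c} = {x\<in>T. u (f x) < c}"
    using assms(3) by auto
  ultimately show "openin (top_of_set T) {x\<in>T. u (f x) < c}" by simp
qed

lemma usc_on_add_continuous:
  assumes "usc_on S u" "continuous_on S r"
  shows "usc_on S (\<lambda>x. u x + ereal (r x))"
  unfolding usc_on_iff_openin
proof
  fix c
  \<comment> \<open>the intermediate real \<open>d\<close> separates the two summands\<close>
  have "{x\<in>S. u x + ereal (r x) < c} = (\<Union>d::real. {x\<in>S. u x < ereal d} \<inter> {x\<in>S. ereal (d + r x) < c})"
  proof (intro equalityI subsetI)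
    fix x assume "x \<in> {x\<in>S. u x + ereal (r x) < c}"
    then have x: "x \<in> S" "u x < c - ereal (r x)"
      by (simp_all add: ereal_less_minus)
    then obtain d where d: "u x < ereal d" "ereal d < c - ereal (r x)"
      using ereal_dense2 by blast
    then have "ereal (d + r x) < c"
      by (simp add: ereal_less_minus)
    with x d show "x \<in> (\<Union>d::real. {x\<in>S. u x < ereal d} \<inter> {x\<in>S. ereal (d + r x) < c})"
      by blast
  next
    fix x assume "x \<in> (\<Union>d::real. {x\<in>S. u x < ereal d} \<inter> {x\<in>S. ereal (d + r x) < c})"
    then obtain d where x: "x \<in> S" "u x < ereal d" "ereal (d + r x) < c" by blast
    have "u x + ereal (r x) \<le> ereal d + ereal (r x)"
      using x(2) by (intro add_right_mono) simp
    also have "\<dots> < c" using x(3) by simp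
    finally show "x \<in> {x\<in>S. u x + ereal (r x) < c}" using x(1) by simp
  qed
  moreover have "openin (top_of_set S) {x\<in>S. ereal (d + r x) < c}" for d
  proof -
    have "usc_on S (\<lambda>x. ereal (d + r x))"
      by (intro usc_on_continuous continuous_intros assms)
    then show ?thesis by (simp add: usc_on_iff_openin)
  qed
  ultimately show "openin (top_of_set S) {x\<in>S. u x + ereal (r x) < c}"
    using assms(1) by (auto simp: usc_on_iff_openin intro!: openin_Union openin_Int)
qed

lemma usc_on_attains_sup:
  assumes "compact K" "K \<noteq> {}" "usc_on K u"
  shows "\<exists>x\<in>K. \<forall>y\<in>K. u y \<le> u x"
proof (rule ccontr)
  assume no: "\<not> (\<exists>x\<in>K. \<forall>y\<in>K. u y \<le> u x)"
  let ?C = "(\<lambda>y. {x\<in>K. u x < u y}) ` K"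
  have cover: "K \<subseteq> \<Union>?C" using no by (auto simp: not_le)
  have "\<forall>c\<in>?C. openin (top_of_set K) c"
    using assms(3) by (auto simp: usc_on_iff_openin)
  with assms(1) cover obtain \<D> where \<D>: "\<D> \<subseteq> ?C" "finite \<D>" "K \<subseteq> \<Union>\<D>"
    unfolding compact_eq_openin_cover by meson
  obtain F where F: "F \<subseteq> K" "finite F" "\<D> = (\<lambda>y. {x\<in>K. u x < u y}) ` F"
    using finite_subset_image[OF \<D>(2,1)] by blast
  have ne: "u ` F \<noteq> {}" using F \<D>(3) assms(2) by auto
  have fin: "finite (u ` F)" using F(2) by simp
  obtain y where y: "y \<in> F" "u y = Max (u ` F)"
    using Max_in[OF fin ne] by auto
  then obtain y' where "y' \<in> F" "u y < u y'" using F \<D>(3) by blast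
  moreover have "u y' \<le> u y" using \<open>y' \<in> F\<close> fin y(2) by simp
  ultimately show False by simp
qed

section \<open>Circle means\<close>

text \<open>
  The nonnegative integral is a supremum over the simple functions below the integrand, so both of
  its occurrences are monotone for arbitrary functions.
\<close>

lemma circle_mean_mono:
  assumes "0 < r" and "\<And>\<zeta>. \<zeta> \<in> sphere z r \<Longrightarrow> u \<zeta> \<le> v \<zeta>"
  shows "circle_mean u z r \<le> circle_mean v z r"
proof -
  have *: "u (z + of_real r * cis t) \<le> v (z + of_real r * cis t)" for t
    using assms by (intro assms(2)) (simp add: dist_norm norm_mult)
  show ?thesis
    unfolding circle_mean_def
    using pi_gt_zero
    by (intro ereal_divide_right_mono ereal_minus_mono)
      (auto simp flip: less_eq_ennreal.rep_eq intro!: nn_integral_mono mult_right_mono e2ennreal_mono *)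
qed

lemma circle_mean_continuous:
  fixes f :: "complex \<Rightarrow> real"
  assumes "0 < r" and "continuous_on (sphere z r) f"
  shows "circle_mean (\<lambda>\<zeta>. ereal (f \<zeta>)) z r
           = ereal (integral {0..2*pi} (\<lambda>t. f (z + of_real r * cis t)) / (2*pi))"
proof -
  define g where "g t = f (z + of_real r * cis t)" for t
  have contg: "continuous_on {0..2*pi} g"
    unfolding g_def
    by (rule continuous_on_compose2[OF assms(2)])
      (use assms(1) in \<open>auto intro!: continuous_intros simp: dist_norm norm_mult\<close>)
  have int: "set_integrable lborel {0..2*pi} g"
    by (rule borel_integrable_atLeastAtMost'[OF contg])
  have ind: "ennreal (g t) * indicator {0..2*pi} t = ennreal (indicator {0..2*pi} t *\<^sub>R g t)"
    "ennreal (- g t) * indicator {0..2*pi} t = ennreal (- (indicator {0..2*pi} t *\<^sub>R g t))" for t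
    by (auto simp: indicator_def)
  let ?p = "\<integral>\<^sup>+t\<in>{0..2*pi}. ennreal (g t) \<partial>lborel" and ?n = "\<integral>\<^sup>+t\<in>{0..2*pi}. ennreal (- g t) \<partial>lborel"
  have fin: "?p \<noteq> \<infinity>" "?n \<noteq> \<infinity>"
    using int unfolding set_integrable_def real_integrable_def ind by auto
  have "enn2real ?p - enn2real ?n = integral {0..2*pi} g"
    using set_borel_integral_eq_integral(2)[OF int] int
    unfolding ind by (simp add: set_lebesgue_integral_def set_integrable_def real_lebesgue_integral_def)
  moreover have "enn2ereal x = ereal (enn2real x)" if "x \<noteq> \<infinity>" for x
    using that by (cases x) auto
  ultimately have "enn2ereal ?p - enn2ereal ?n = ereal (integral {0..2*pi} g)"
    using fin by simp
  then show ?thesis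
    unfolding circle_mean_def g_def[symmetric] by simp
qed

lemma mean_value_Re_holomorphic:
  assumes "0 < r" "G holomorphic_on T" "cball z r \<subseteq> T"
  shows "integral {0..2*pi} (\<lambda>t. Re (G (z + of_real r * cis t))) = 2*pi * Re (G z)"
proof -
  have hol: "G holomorphic_on cball z r"
    using assms holomorphic_on_subset by blast
  have "((\<lambda>u. G u/(u-z)) has_contour_integral (2 * of_real pi * \<i> * G z)) (part_circlepath z r 0 (2*pi))"
    using Cauchy_integral_circlepath_simple[OF hol, of z] assms(1) by (simp add: circlepath_def)
  then have "((\<lambda>t. G (z + of_real r * cis t) * \<i>) has_integral (2 * of_real pi * \<i> * G z)) {0..2*pi}"
    using assms(1) by (subst (asm) has_contour_integral_part_circlepath_iff) (auto simp: field_simps)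
  from has_integral_mult_left[OF this, of "-\<i>"]
  have "((\<lambda>t. G (z + of_real r * cis t)) has_integral (2 * of_real pi * G z)) {0..2*pi}"
    by (simp add: algebra_simps)
  from has_integral_Re[OF this] show ?thesis
    by (simp add: integral_unique mult.assoc)
qed

lemma circle_mean_Re_holomorphic:
  assumes "0 < r" "G holomorphic_on T" "cball z r \<subseteq> T"
  shows "circle_mean (\<lambda>\<zeta>. ereal (Re (G \<zeta>))) z r = ereal (Re (G z))"
proof -
  have "sphere z r \<subseteq> T" using assms(3) by auto
  then have "continuous_on (sphere z r) (\<lambda>\<zeta>. Re (G \<zeta>))"
    using assms(2) by (intro continuous_intros) (metis continuous_on_subset holomorphic_on_imp_continuous_on)
  then show ?thesis
    using assms by (simp add: circle_mean_continuous mean_value_Re_holomorphic)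
qed

text \<open>
  Real parts of holomorphic functions serve as the harmonic majorants throughout: on them the circle
  mean is the value at the centre.
\<close>

lemma subharmonic_on_le_Re_holomorphic:
  assumes "subharmonic_on S u" "0 < r" "cball z r \<subseteq> S" "G holomorphic_on T" "cball z r \<subseteq> T"
    and "\<And>\<zeta>. \<zeta> \<in> sphere z r \<Longrightarrow> u \<zeta> \<le> ereal (Re (G \<zeta>))"
  shows "u z \<le> ereal (Re (G z))"
proof -
  have "u z \<le> circle_mean u z r"
    using assms(1,2,3) by (auto simp: subharmonic_on_def)
  also have "\<dots> \<le> circle_mean (\<lambda>\<zeta>. ereal (Re (G \<zeta>))) z r"
    using assms(2,6) by (rule circle_mean_mono)
  also have "\<dots> = ereal (Re (G z))"
    using assms by (intro circle_mean_Re_holomorphic)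
  finally show ?thesis .
qed

section \<open>Domination by real parts of holomorphic functions characterises subharmonicity\<close>

text \<open>
  On the circle \<open>y * cnj y\<close> is the constant \<open>r^2\<close>, so a factor
  \<open>y\<close> lowers the degree of the antiholomorphic part instead of producing a mixed
  monomial.
\<close>

lemma trig_poly_mult:
  "\<exists>p' q'. \<forall>y. norm y = r \<longrightarrow> (poly p y + cnj (poly q y)) * poly s y = poly p' y + cnj (poly q' y)"
proof (induction s arbitrary: p q)
  case 0
  show ?case by (rule exI[of _ 0], rule exI[of _ 0]) simp
next
  case (pCons a s)
  obtain b q0 where q: "q = pCons b q0" by (cases q) auto
  define P Q where "P = pCons 0 p + [:0, cnj b:]" and "Q = smult (of_real (r^2)) q0"
  obtain p' q' where IH: "\<And>y. norm y = r \<Longrightarrow> (poly P y + cnj (poly Q y)) * poly s y = poly p' y + cnj (poly q' y)"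
    using pCons.IH[of P Q] by blast
  show ?case
  proof (intro exI allI impI)
    fix y :: complex assume y: "norm y = r"
    have yy: "y * cnj y = of_real (r^2)"
      using y complex_norm_square[of y] by simp
    have "y * cnj (poly q y) = y * cnj b + (y * cnj y) * cnj (poly q0 y)"
      by (simp add: q algebra_simps)
    then have yP: "y * (poly p y + cnj (poly q y)) = poly P y + cnj (poly Q y)"
      unfolding yy by (simp add: P_def Q_def algebra_simps)
    have "(poly p y + cnj (poly q y)) * poly (pCons a s) y
       = a * (poly p y + cnj (poly q y)) + (poly P y + cnj (poly Q y)) * poly s y"
      unfolding yP[symmetric] by (simp add: algebra_simps)
    also have "\<dots> = poly (smult a p + p') y + cnj (poly (smult (cnj a) q + q') y)"
      unfolding IH[OF y] by (simp add: algebra_simps)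
    finally show "(poly p y + cnj (poly q y)) * poly (pCons a s) y
       = poly (smult a p + p') y + cnj (poly (smult (cnj a) q + q') y)" .
  qed
qed

text \<open>
  On the circle of radius \<open>r\<close> about \<open>z\<close>, a sum of a polynomial and a
  conjugated polynomial in the displacement \<open>y\<close> is a trigonometric polynomial of the
  argument of \<open>y\<close>. Such a real-valued function is the boundary value of the real part
  of the polynomial \<open>p + q\<close>.
\<close>

definition trig_polynomial :: "complex \<Rightarrow> real \<Rightarrow> (complex \<Rightarrow> real) \<Rightarrow> bool" where
  "trig_polynomial z r f \<longleftrightarrow>
     (\<exists>p q. \<forall>y. norm y = r \<longrightarrow> of_real (f (z + y)) = poly p y + cnj (poly q y))"

lemma trig_polynomial_imp_Re_poly:
  assumes "trig_polynomial z r f"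
  obtains p where "\<And>\<zeta>. \<zeta> \<in> sphere z r \<Longrightarrow> f \<zeta> = Re (poly p (\<zeta> - z))"
proof -
  obtain p q where pq: "\<And>y. norm y = r \<Longrightarrow> of_real (f (z + y)) = poly p y + cnj (poly q y)"
    using assms by (auto simp: trig_polynomial_def)
  have "f \<zeta> = Re (poly (p + q) (\<zeta> - z))" if "\<zeta> \<in> sphere z r" for \<zeta>
    using arg_cong[OF pq[of "\<zeta> - z"], of Re] that by (simp add: dist_norm norm_minus_commute)
  then show thesis by (rule that)
qed

lemma trig_polynomial_add:
  assumes "trig_polynomial z r f" "trig_polynomial z r g"
  shows "trig_polynomial z r (\<lambda>x. f x + g x)"
proof -
  obtain p q where 1: "\<And>y. norm y = r \<Longrightarrow> of_real (f (z + y)) = poly p y + cnj (poly q y)"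
    using assms by (auto simp: trig_polynomial_def)
  obtain p' q' where 2: "\<And>y. norm y = r \<Longrightarrow> of_real (g (z + y)) = poly p' y + cnj (poly q' y)"
    using assms by (auto simp: trig_polynomial_def)
  show ?thesis unfolding trig_polynomial_def
    by (rule exI[of _ "p + p'"], rule exI[of _ "q + q'"]) (simp add: 1 2)
qed

lemma trig_polynomial_mult:
  assumes "trig_polynomial z r f" "trig_polynomial z r g"
  shows "trig_polynomial z r (\<lambda>x. f x * g x)"
proof -
  obtain p q where 1: "\<And>y. norm y = r \<Longrightarrow> of_real (f (z + y)) = poly p y + cnj (poly q y)"
    using assms by (auto simp: trig_polynomial_def)
  obtain p' q' where 2: "\<And>y. norm y = r \<Longrightarrow> of_real (g (z + y)) = poly p' y + cnj (poly q' y)"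
    using assms by (auto simp: trig_polynomial_def)
  obtain a b where 3: "\<And>y. norm y = r \<Longrightarrow> (poly p y + cnj (poly q y)) * poly p' y = poly a y + cnj (poly b y)"
    using trig_poly_mult by metis
  obtain c d where 4: "\<And>y. norm y = r \<Longrightarrow> (poly q y + cnj (poly p y)) * poly q' y = poly c y + cnj (poly d y)"
    using trig_poly_mult by metis
  have "of_real (f (z + y) * g (z + y)) = poly (a + d) y + cnj (poly (b + c) y)" if y: "norm y = r" for y
  proof -
    have "of_real (f (z + y) * g (z + y)) = (poly p y + cnj (poly q y)) * poly p' y
       + cnj ((poly q y + cnj (poly p y)) * poly q' y)"
      unfolding of_real_mult 1[OF y] 2[OF y] by (simp add: algebra_simps)
    also have "\<dots> = poly (a + d) y + cnj (poly (b + c) y)"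
      unfolding 3[OF y] 4[OF y] by simp
    finally show ?thesis .
  qed
  then show ?thesis unfolding trig_polynomial_def by blast
qed

lemma trig_polynomial_real_polynomial_function:
  assumes "real_polynomial_function f"
  shows "trig_polynomial z r f"
  using assms
proof (induction rule: real_polynomial_function.induct)
  case (linear f)
  interpret bounded_linear f by fact
  have fy: "f y = Re y * f 1 + Im y * f \<i>" for y
  proof -
    have "f y = f (Re y *\<^sub>R 1 + Im y *\<^sub>R \<i>)"
      by (intro arg_cong[of _ _ f]) (simp add: complex_eq_iff)
    then show ?thesis by (simp only: add scale real_scaleR_def)
  qed
  define c where "c = Complex (f 1) (- f \<i>) / 2"
  have "of_real (f (z + y)) = poly [:of_real (f z), c:] y + cnj (poly [:0, c:] y)" for y
  proof (rule complex_eqI)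
    have "f (z + y) = f z + (Re y * f 1 + Im y * f \<i>)"
      unfolding add using fy[of y] by (rule arg_cong)
    then show "Re (of_real (f (z + y))) = Re (poly [:of_real (f z), c:] y + cnj (poly [:0, c:] y))"
      by (simp add: c_def)
  qed simp
  then show ?case unfolding trig_polynomial_def by blast
next
  case (const c)
  show ?case unfolding trig_polynomial_def
    by (rule exI[of _ "[:of_real c:]"], rule exI[of _ 0]) simp
qed (auto intro: trig_polynomial_add trig_polynomial_mult)

text \<open>
  The Stone-Weierstrass theorem gives real polynomials in two variables, and these are trigonometric
  polynomials on a circle. This approximate solution of the Dirichlet problem takes the place of the
  Poisson integral.
\<close>

lemma Re_holomorphic_approximation_on_circle:
  fixes f :: "complex \<Rightarrow> real"
  assumes "continuous_on (sphere z r) f" "0 < e"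
  obtains G where "G holomorphic_on UNIV" "\<And>\<zeta>. \<zeta> \<in> sphere z r \<Longrightarrow> \<bar>f \<zeta> - Re (G \<zeta>)\<bar> < e"
proof -
  obtain g where g: "real_polynomial_function g" "\<And>x. x \<in> sphere z r \<Longrightarrow> \<bar>f x - g x\<bar> < e"
    using Stone_Weierstrass_real_polynomial_function[OF compact_sphere assms] by metis
  obtain p where p: "\<And>\<zeta>. \<zeta> \<in> sphere z r \<Longrightarrow> g \<zeta> = Re (poly p (\<zeta> - z))"
    using trig_polynomial_imp_Re_poly[OF trig_polynomial_real_polynomial_function[OF g(1)]] by metis
  show thesis
    by (rule that[of "\<lambda>\<zeta>. poly p (\<zeta> - z)"])
      (use g(2) p in \<open>auto intro!: holomorphic_intros\<close>)
qed

text \<open>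
  A holomorphic \<open>G\<close> with \<open>f \<le> Re G \<le> f + e\<close> on the circle bounds
  the value of \<open>f\<close> at the centre by the mean of \<open>f\<close> plus \<open>e\<close>.
  The gain over the definition is that domination passes to a maximum of two functions and needs no
  integration to verify.
\<close>

lemma subharmonic_onI_Re_holomorphic:
  fixes f :: "complex \<Rightarrow> real"
  assumes "open S" "continuous_on S f"
    and dom: "\<And>z r G. 0 < r \<Longrightarrow> cball z r \<subseteq> S \<Longrightarrow> G holomorphic_on UNIV \<Longrightarrow>
            (\<And>\<zeta>. \<zeta> \<in> sphere z r \<Longrightarrow> f \<zeta> \<le> Re (G \<zeta>)) \<Longrightarrow> f z \<le> Re (G z)"
  shows "subharmonic_on S (\<lambda>\<zeta>. ereal (f \<zeta>))"
  unfolding subharmonic_on_def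
proof (intro conjI ballI allI impI)
  show "usc_on S (\<lambda>\<zeta>. ereal (f \<zeta>))" using assms(2) by (rule usc_on_continuous)
  fix z r assume zr: "0 < r \<and> cball z r \<subseteq> S"
  then have "sphere z r \<subseteq> S" by auto
  with assms(2) have contf: "continuous_on (sphere z r) f" by (rule continuous_on_subset)
  let ?I = "integral {0..2*pi} (\<lambda>t. f (z + of_real r * cis t))"
  have "f z \<le> ?I / (2*pi)"
  proof (rule field_le_epsilon)
    fix e :: real assume e: "0 < e"
    obtain G where G: "G holomorphic_on UNIV" "\<And>\<zeta>. \<zeta> \<in> sphere z r \<Longrightarrow> \<bar>f \<zeta> - Re (G \<zeta>)\<bar> < e/2"
      using Re_holomorphic_approximation_on_circle[OF contf, of "e/2"] e by auto
    have *: "z + of_real r * cis t \<in> sphere z r" for t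
      using zr by (simp add: dist_norm norm_mult)
    have up: "f z \<le> Re (G z + of_real (e/2))"
    proof (rule dom)
      show "f \<zeta> \<le> Re (G \<zeta> + of_real (e/2))" if "\<zeta> \<in> sphere z r" for \<zeta>
        using G(2)[OF that] unfolding plus_complex.sel Re_complex_of_real by linarith
    qed (use zr G(1) in \<open>auto intro!: holomorphic_intros\<close>)
    have "2*pi * Re (G z - of_real (e/2)) \<le> ?I"
      unfolding mean_value_Re_holomorphic[of r "\<lambda>\<zeta>. G \<zeta> - of_real (e/2)" UNIV z, symmetric,
        OF conjunct1[OF zr] holomorphic_on_diff[OF G(1) holomorphic_on_const] subset_UNIV]
    proof (rule integral_le)
      have "continuous_on {0..2 * pi} (\<lambda>t. G (z + of_real r * cis t))"
        by (intro continuous_on_compose2[OF holomorphic_on_imp_continuous_on[OF G(1)]] continuous_intros) auto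
      then show "(\<lambda>t. Re (G (z + of_real r * cis t) - of_real (e / 2))) integrable_on {0..2 * pi}"
        by (intro integrable_continuous_real continuous_intros)
      show "(\<lambda>t. f (z + of_real r * cis t)) integrable_on {0..2 * pi}"
        by (intro integrable_continuous_real continuous_on_compose2[OF contf] continuous_intros)
          (use * in auto)
      show "Re (G (z + of_real r * cis t) - of_real (e / 2)) \<le> f (z + of_real r * cis t)" for t
        using G(2)[OF *, of t] unfolding minus_complex.sel Re_complex_of_real by linarith
    qed
    then have "Re (G z) - e/2 \<le> ?I / (2*pi)"
      using pi_gt_zero by (subst pos_le_divide_eq) (simp_all add: mult.commute)
    with up show "f z \<le> ?I / (2*pi) + e"
      by simp
  qed
  then show "ereal (f z) \<le> circle_mean (\<lambda>\<zeta>. ereal (f \<zeta>)) z r"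
    using zr contf by (simp add: circle_mean_continuous)
qed (use assms in auto)

section \<open>The maximum principle along a holomorphic disc\<close>

lemma norm_vector_scalar_mult: "norm (a *s x) = cmod a * norm (x :: complex ^ 'n)"
  by (simp add: norm_vec_def L2_set_def norm_mult power_mult_distrib flip: sum_distrib_left)
    (simp add: real_sqrt_mult)

lemma continuous_on_vector_scalar_mult [continuous_intros]:
  fixes f :: "'a::topological_space \<Rightarrow> complex" and g :: "'a \<Rightarrow> complex ^ 'n"
  assumes "continuous_on S f" "continuous_on S g"
  shows "continuous_on S (\<lambda>x. f x *s g x)"
  unfolding vector_scalar_mult_def
  by (intro continuous_on_vec_lambda continuous_intros assms)

lemma holomorphic_vector_linear_approximation:
  fixes \<phi> :: "complex \<Rightarrow> complex ^ 'n"
  assumes "\<And>i. (\<lambda>\<zeta>. \<phi> \<zeta> $ i) holomorphic_on T" "open T" "x \<in> T" "0 < e"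
  shows "\<exists>d>0. \<forall>\<tau>. norm \<tau> < d \<longrightarrow>
           norm (\<phi> (x + \<tau>) - \<phi> x - \<tau> *s (\<chi> i. deriv (\<lambda>\<zeta>. \<phi> \<zeta> $ i) x)) \<le> e * norm \<tau>"
proof -
  define q where "q \<tau> = \<phi> (x + \<tau>) - \<phi> x - \<tau> *s (\<chi> i. deriv (\<lambda>\<zeta>. \<phi> \<zeta> $ i) x)" for \<tau>
  let ?e = "e / CARD('n)"
  have e: "?e > 0" using assms(4) by simp
  have "\<forall>i. \<exists>d>0. \<forall>\<tau>. norm \<tau> < d \<longrightarrow> norm (q \<tau> $ i) \<le> ?e * norm \<tau>"
  proof
    fix i
    have "((\<lambda>\<zeta>. \<phi> \<zeta> $ i) has_field_derivative deriv (\<lambda>\<zeta>. \<phi> \<zeta> $ i) x) (at x)"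
      using assms by (intro holomorphic_derivI)
    then obtain d where d: "d > 0"
      "\<And>y. norm (y - x) < d \<Longrightarrow> norm (\<phi> y $ i - \<phi> x $ i - deriv (\<lambda>\<zeta>. \<phi> \<zeta> $ i) x * (y - x)) \<le> ?e * norm (y - x)"
      using e unfolding has_field_derivative_def has_derivative_at_alt by blast
    show "\<exists>d>0. \<forall>\<tau>. norm \<tau> < d \<longrightarrow> norm (q \<tau> $ i) \<le> ?e * norm \<tau>"
      using d(2)[of "x + _"] d(1) by (intro exI[of _ d]) (auto simp: q_def mult.commute)
  qed
  then obtain d where d: "\<And>i. d i > 0" "\<And>i \<tau>. norm \<tau> < d i \<Longrightarrow> norm (q \<tau> $ i) \<le> ?e * norm \<tau>"
    by metis
  define D where "D = Min (range d)"
  have D: "D > 0" "\<And>i. D \<le> d i"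
    unfolding D_def using d(1) by auto
  have "norm (q \<tau>) \<le> e * norm \<tau>" if "norm \<tau> < D" for \<tau>
  proof -
    have "norm (q \<tau>) \<le> (\<Sum>i\<in>UNIV. norm (q \<tau> $ i))"
      unfolding norm_vec_def by (rule L2_set_le_sum) simp
    also have "\<dots> \<le> (\<Sum>i\<in>(UNIV :: 'n set). ?e * norm \<tau>)"
      using that D(2) by (intro sum_mono d(2)) (rule less_le_trans)
    also have "\<dots> = e * norm \<tau>" by simp
    finally show ?thesis .
  qed
  with D(1) show ?thesis unfolding q_def by blast
qed

lemma Re_of_real_mult: "Re (of_real a * z) = a * Re z"
  by simp

lemma norm_add_cnj_expand:
  "(norm (a + b))\<^sup>2 = (norm a)\<^sup>2 + 2 * Re (cnj a * b) + (norm (b :: complex))\<^sup>2"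
  unfolding cmod_power2 by (simp add: power2_eq_square algebra_simps)

lemma norm_diff_vec_expand:
  fixes \<eta> q :: "complex ^ 'n"
  shows "(norm (\<eta> - q))\<^sup>2 = (norm \<eta>)\<^sup>2 - 2 * Re (\<Sum>i\<in>UNIV. cnj (\<eta> $ i) * q $ i) + (norm q)\<^sup>2"
proof -
  have "Re (\<Sum>i\<in>UNIV. cnj (\<eta> $ i) * q $ i) = \<eta> \<bullet> q"
    by (simp add: inner_vec_def inner_complex_def)
  then show ?thesis
    by (simp add: power2_norm_eq_inner inner_diff_left inner_diff_right inner_commute)
qed

text \<open>
  Suppose that \<open>u (\<phi> c)\<close> exceeds the bound on the boundary of the disc. Then for
  small \<open>\<epsilon>\<close>, small \<open>\<rho>\<close> and large \<open>L\<close> the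
  function \<open>u (\<phi> \<zeta> + \<eta>) + \<epsilon> |\<zeta> - c|^2 - L |\<eta>|^2\<close> on
  \<open>|\<zeta> - c| \<le> s\<close>, \<open>|\<eta>| \<le> \<rho>\<close> has its maximum at an
  interior point \<open>(x, \<eta>)\<close>. Move from there by \<open>\<tau>\<close> in the
  direction of the complex line tangent to the disc at \<open>x\<close>. This point of the line is
  \<open>\<phi> (x + \<tau>) + (\<eta> - q \<tau>)\<close>, where the error \<open>q\<close> of the
  linear approximation is holomorphic with \<open>q 0 = 0\<close> and \<open>q \<tau> =
  o(\<tau>)\<close>. In the mean over \<open>|\<tau>| = r\<close> the first correction therefore
  gains \<open>\<epsilon> r^2\<close>, while the second loses only \<open>L |q|^2 = o(r^2)\<close>,
  because its cross term is the real part of a holomorphic function that vanishes at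
  \<open>0\<close>. So \<open>u\<close> on this line lies below the mean value inequality.
\<close>

lemma plurisubharmonic_on_disc_max_principle:
  fixes u :: "complex ^ 'n \<Rightarrow> ereal" and \<phi> :: "complex \<Rightarrow> complex ^ 'n"
  assumes psh: "plurisubharmonic_on W u"
    and hol: "\<And>i. (\<lambda>\<zeta>. \<phi> \<zeta> $ i) holomorphic_on T" and T: "open T" "cball c s \<subseteq> T" and s: "0 < s"
    and W: "\<phi> ` cball c s \<subseteq> W"
    and bd: "\<And>\<zeta>. \<zeta> \<in> sphere c s \<Longrightarrow> u (\<phi> \<zeta>) \<le> ereal C"
  shows "u (\<phi> c) \<le> ereal C"
proof (rule ccontr)
  assume neg: "\<not> u (\<phi> c) \<le> ereal C"
  have openW: "open W" and uscW: "usc_on W u" and fin: "\<And>x. x \<in> W \<Longrightarrow> u x < \<infinity>"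
    using psh by (auto simp: plurisubharmonic_on_def)
  have cW: "\<phi> c \<in> W" using W s by auto
  obtain U0 where U0: "u (\<phi> c) = ereal U0" "C < U0"
    using neg fin[OF cW] by (cases "u (\<phi> c)") auto
  \<comment> \<open>half of the gap between \<open>C\<close> and \<open>U0\<close> absorbs the thickening of the boundary circle,
      and the term with \<open>\<epsilon>\<close> uses up only half of what remains\<close>
  define C1 where "C1 = (C + U0) / 2"
  define \<epsilon> where "\<epsilon> = (U0 - C1) / (2 * s\<^sup>2)"
  have C1: "C < C1" "C1 < U0" using U0 by (auto simp: C1_def)
  have \<epsilon>: "\<epsilon> > 0" "C1 + \<epsilon> * s\<^sup>2 < U0" 
    using C1 s by (auto simp: \<epsilon>_def field_simps)
  have cont\<phi>: "continuous_on (cball c s) \<phi>"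
  proof -
    have "continuous_on (cball c s) (\<lambda>\<zeta>. \<phi> \<zeta> $ i)" for i
      using hol T(2) continuous_on_subset holomorphic_on_imp_continuous_on by blast
    then have "continuous_on (cball c s) (\<lambda>\<zeta>. \<chi> i. \<phi> \<zeta> $ i)"
      by (intro continuous_on_vec_lambda)
    then show ?thesis by simp
  qed
  define V where "V = {x\<in>W. u x < ereal C1}"
  have openV: "open V"
    using uscW openin_open_eq[OF openW] unfolding V_def usc_on_iff_openin by blast
  have sphV: "\<phi> ` sphere c s \<subseteq> V"
  proof
    fix x assume "x \<in> \<phi> ` sphere c s"
    then obtain \<zeta> where "\<zeta> \<in> sphere c s" "x = \<phi> \<zeta>" by auto
    moreover have "ereal C < ereal C1" using C1 by simp
    ultimately show "x \<in> V"
      using le_less_trans[OF bd[of \<zeta>]] W by (auto simp: V_def)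
  qed
  obtain \<rho>1 where \<rho>1: "\<rho>1 > 0" "{x. infdist x (\<phi> ` cball c s) \<le> \<rho>1} \<subseteq> W"
    using compact_in_open_separated[OF _ compact_continuous_image[OF cont\<phi> compact_cball] openW W] s by auto
  have "continuous_on (sphere c s) \<phi>"
    using cont\<phi> by (rule continuous_on_subset) (rule sphere_cball)
  then obtain \<rho>2 where \<rho>2: "\<rho>2 > 0" "{x. infdist x (\<phi> ` sphere c s) \<le> \<rho>2} \<subseteq> V"
    using compact_in_open_separated[OF _ compact_continuous_image[OF _ compact_sphere] openV sphV] s by auto
  define \<rho> where "\<rho> = min \<rho>1 \<rho>2"
  have \<rho>: "\<rho> > 0" using \<rho>1 \<rho>2 by (simp add: \<rho>_def)
  have inW: "\<phi> \<zeta> + \<eta> \<in> W" if "\<zeta> \<in> cball c s" "norm \<eta> \<le> \<rho>" for \<zeta> \<eta>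
    using infdist_le[of "\<phi> \<zeta>" "\<phi> ` cball c s" "\<phi> \<zeta> + \<eta>"] that \<rho>1(2) by (force simp: \<rho>_def dist_norm)
  have inV: "u (\<phi> \<zeta> + \<eta>) < ereal C1" if "\<zeta> \<in> sphere c s" "norm \<eta> \<le> \<rho>" for \<zeta> \<eta>
    using infdist_le[of "\<phi> \<zeta>" "\<phi> ` sphere c s" "\<phi> \<zeta> + \<eta>"] that \<rho>2(2) by (force simp: \<rho>_def dist_norm V_def)
  define K where "K = cball c s \<times> cball (0 :: complex ^ 'n) \<rho>"
  have K: "compact K" "(c, 0) \<in> K" unfolding K_def using s \<rho> by (auto intro: compact_Times)
  then have Kne: "K \<noteq> {}" by auto
  have uscK: "usc_on K (\<lambda>p. u (\<phi> (fst p) + snd p))"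
    unfolding K_def using inW
    by (intro usc_on_compose[OF uscW] continuous_intros continuous_on_compose2[OF cont\<phi>]) auto
  obtain p0 where p0: "p0 \<in> K" "\<And>p. p \<in> K \<Longrightarrow> u (\<phi> (fst p) + snd p) \<le> u (\<phi> (fst p0) + snd p0)"
    using usc_on_attains_sup[OF K(1) Kne uscK] by blast
  have "\<phi> (fst p0) + snd p0 \<in> W" using p0(1) inW by (auto simp: K_def)
  from fin[OF this] obtain M0 where M0: "u (\<phi> (fst p0) + snd p0) \<le> ereal M0"
    by (cases "u (\<phi> (fst p0) + snd p0)") auto
  \<comment> \<open>with this \<open>L\<close> the penalty on \<open>|\<eta>| = \<rho>\<close> outweighs the upper bound \<open>M0\<close> for \<open>u\<close>\<close>
  define L where "L = (\<bar>M0\<bar> + \<epsilon> * s\<^sup>2 + \<bar>U0\<bar> + 1) / \<rho>\<^sup>2"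
  have "\<bar>M0\<bar> + \<epsilon> * s\<^sup>2 + \<bar>U0\<bar> + 1 > 0" using \<epsilon>(1) by (simp add: add_nonneg_pos)
  then have L: "L > 0" "M0 + \<epsilon> * s\<^sup>2 - L * \<rho>\<^sup>2 < U0"
    using \<rho> by (auto simp: L_def)
  define R where "R p = \<epsilon> * (norm (fst p - c))\<^sup>2 - L * (norm (snd p))\<^sup>2" for p :: "complex \<times> (complex ^ 'n)"
  have "usc_on K (\<lambda>p. u (\<phi> (fst p) + snd p) + ereal (R p))"
    unfolding R_def by (intro usc_on_add_continuous[OF uscK] continuous_intros)
  then obtain p where p: "p \<in> K"
    "\<And>p'. p' \<in> K \<Longrightarrow> u (\<phi> (fst p') + snd p') + ereal (R p') \<le> u (\<phi> (fst p) + snd p) + ereal (R p)"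
    using usc_on_attains_sup[OF K(1) Kne] by blast
  obtain x \<eta> where pe: "p = (x, \<eta>)" by (cases p)
  have xcb: "x \<in> cball c s" "norm \<eta> \<le> \<rho>" using p(1) by (auto simp: pe K_def)
  have ge: "ereal U0 \<le> u (\<phi> x + \<eta>) + ereal (R (x, \<eta>))"
    using p(2)[OF K(2)] U0(1) by (simp add: pe R_def)
  obtain Us where Us: "u (\<phi> x + \<eta>) = ereal Us"
    using ge fin[OF inW[OF xcb]] by (cases "u (\<phi> x + \<eta>)") auto
  have ge': "U0 \<le> Us + \<epsilon> * (norm (x - c))\<^sup>2 - L * (norm \<eta>)\<^sup>2"
    using ge by (simp add: Us R_def)
  have nxc: "norm (x - c) \<le> s" using xcb(1) by (simp add: dist_norm norm_minus_commute)
  then have sq: "\<epsilon> * (norm (x - c))\<^sup>2 \<le> \<epsilon> * s\<^sup>2"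
    using \<epsilon>(1) by (intro mult_left_mono power_mono) auto
  have xb: "norm (x - c) < s"
  proof (rule ccontr)
    assume "\<not> norm (x - c) < s"
    then have "x \<in> sphere c s" using nxc by (simp add: dist_norm norm_minus_commute)
    from inV[OF this xcb(2)] have "Us < C1" by (simp add: Us)
    moreover have "0 \<le> L * (norm \<eta>)\<^sup>2" using L(1) by simp
    ultimately show False using ge' sq \<epsilon>(2) by linarith
  qed
  have \<eta>b: "norm \<eta> < \<rho>"
  proof (rule ccontr)
    assume "\<not> norm \<eta> < \<rho>"
    then have "norm \<eta> = \<rho>" using xcb(2) by simp
    moreover have "Us \<le> M0" using p0(2)[OF p(1)] M0 by (simp add: pe Us) (metis Us ereal_less_eq(3) order_trans)
    ultimately show False using ge' sq L(2) by simp
  qed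
  define w where "w = (\<chi> i. deriv (\<lambda>\<zeta>. \<phi> \<zeta> $ i) x)"
  define q where "q \<tau> = \<phi> (x + \<tau>) - \<phi> x - \<tau> *s w" for \<tau>
  \<comment> \<open>if \<open>|q \<tau>| \<le> e |\<tau>|\<close>, then \<open>L |q \<tau>|^2\<close> is at most half of the gain \<open>\<epsilon> |\<tau>|^2\<close>\<close>
  define e where "e = min 1 (sqrt (\<epsilon> / (2 * L)))"
  have e: "0 < e" "e \<le> 1" using \<epsilon>(1) L(1) by (auto simp: e_def)
  have "e\<^sup>2 \<le> (sqrt (\<epsilon> / (2 * L)))\<^sup>2" using e by (intro power_mono) (auto simp: e_def)
  then have eL: "L * e\<^sup>2 \<le> \<epsilon> / 2" using \<epsilon>(1) L(1) by (simp add: field_simps)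
  have xT: "x \<in> T" using xcb(1) T(2) by auto
  obtain d where d: "d > 0" "\<And>\<tau>. norm \<tau> < d \<Longrightarrow> norm (q \<tau>) \<le> e * norm \<tau>"
    using holomorphic_vector_linear_approximation[OF hol T(1) xT e(1)] unfolding q_def w_def by auto
  define r where "r = min (d / 2) (min (s - norm (x - c)) (\<rho> - norm \<eta>))"
  have r: "0 < r" "r < d" "r \<le> s - norm (x - c)" "r \<le> \<rho> - norm \<eta>"
    using d(1) xb \<eta>b by (auto simp: r_def)
  have inK: "(x + \<tau>, \<eta> - q \<tau>) \<in> K" if "norm \<tau> \<le> r" for \<tau>
  proof -
    have "norm (x + \<tau> - c) \<le> norm (x - c) + norm \<tau>"
      using norm_triangle_ineq[of "x - c" \<tau>] by (simp add: algebra_simps)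
    moreover have "norm (q \<tau>) \<le> norm \<tau>"
      using d(2)[of \<tau>] that r(2) e mult_right_mono[OF e(2), of "norm \<tau>"] by auto
    moreover have "norm (\<eta> - q \<tau>) \<le> norm \<eta> + norm (q \<tau>)" by (rule norm_triangle_ineq4)
    ultimately show ?thesis
      using that r unfolding K_def by (simp add: dist_norm norm_minus_commute)
  qed
  have line: "\<phi> (x + \<tau>) + (\<eta> - q \<tau>) = (\<phi> x + \<eta>) + \<tau> *s w" for \<tau>
    by (simp add: q_def)
  define S where "S = {\<tau>. (\<phi> x + \<eta>) + \<tau> *s w \<in> W}"
  have sub: "subharmonic_on S (\<lambda>\<tau>. u ((\<phi> x + \<eta>) + \<tau> *s w))"
    using psh unfolding S_def plurisubharmonic_on_def by blast
  have cbS: "cball 0 r \<subseteq> S"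
  proof
    fix \<tau> :: complex assume "\<tau> \<in> cball 0 r"
    then have "(x + \<tau>, \<eta> - q \<tau>) \<in> K" by (intro inK) simp
    then have "\<phi> (x + \<tau>) + (\<eta> - q \<tau>) \<in> W" by (intro inW) (auto simp: K_def)
    then show "\<tau> \<in> S" unfolding S_def line by simp
  qed
  \<comment> \<open>maximality bounds \<open>u\<close> on the circle by the real part of this function, which is smaller than
      \<open>Us\<close> at the centre\<close>
  define G where "G \<tau> = of_real (Us - \<epsilon> * r\<^sup>2 / 2) - of_real (2 * \<epsilon>) * (cnj (x - c) * \<tau>)
      - of_real (2 * L) * (\<Sum>i\<in>UNIV. cnj (\<eta> $ i) * q \<tau> $ i)" for \<tau>
  have T': "cball 0 r \<subseteq> {\<tau>. x + \<tau> \<in> T}"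
  proof
    fix \<tau> :: complex assume "\<tau> \<in> cball 0 r"
    then have "(x + \<tau>, \<eta> - q \<tau>) \<in> K" by (intro inK) simp
    then show "\<tau> \<in> {\<tau>. x + \<tau> \<in> T}" using T(2) by (auto simp: K_def)
  qed
  have holG: "G holomorphic_on {\<tau>. x + \<tau> \<in> T}"
  proof -
    have "(\<lambda>\<tau>. \<phi> (x + \<tau>) $ i) holomorphic_on {\<tau>. x + \<tau> \<in> T}" for i
      by (rule holomorphic_on_compose_gen[OF _ hol[of i], of "\<lambda>\<tau>. x + \<tau>", unfolded o_def])
        (auto intro!: holomorphic_intros)
    then show ?thesis
      unfolding G_def q_def by (auto intro!: holomorphic_intros)
  qed
  have "u ((\<phi> x + \<eta>) + 0 *s w) \<le> ereal (Re (G 0))"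
  proof (rule subharmonic_on_le_Re_holomorphic[OF sub r(1) cbS holG T'])
    fix \<tau> :: complex assume "\<tau> \<in> sphere 0 r"
    then have \<tau>: "norm \<tau> = r" by simp
    have le: "u ((\<phi> x + \<eta>) + \<tau> *s w) + ereal (R (x + \<tau>, \<eta> - q \<tau>)) \<le> ereal (Us + R (x, \<eta>))"
      using p(2)[OF inK[of \<tau>]] \<tau> by (simp add: pe line Us)
    have qn: "(norm (q \<tau>))\<^sup>2 \<le> (e * r)\<^sup>2"
      using d(2)[of \<tau>] \<tau> r(2) by (intro power_mono) auto
    have qL: "L * (norm (q \<tau>))\<^sup>2 \<le> \<epsilon> * r\<^sup>2 / 2"
    proof -
      have "L * (norm (q \<tau>))\<^sup>2 \<le> (L * e\<^sup>2) * r\<^sup>2"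
        using mult_left_mono[OF qn, of L] L(1) by (simp add: power_mult_distrib mult.assoc)
      also have "\<dots> \<le> \<epsilon> / 2 * r\<^sup>2" using eL by (intro mult_right_mono) auto
      finally show ?thesis by simp
    qed
    have sqx: "(norm (x + \<tau> - c))\<^sup>2 = (norm (x - c))\<^sup>2 + 2 * Re (cnj (x - c) * \<tau>) + r\<^sup>2"
      using norm_add_cnj_expand[of "x - c" \<tau>] by (simp add: \<tau> algebra_simps)
    have 1: "\<epsilon> * (norm (x + \<tau> - c))\<^sup>2 = \<epsilon> * (norm (x - c))\<^sup>2 + 2 * \<epsilon> * Re (cnj (x - c) * \<tau>) + \<epsilon> * r\<^sup>2"
      unfolding sqx by (simp only: distrib_left mult_ac)
    have 2: "L * (norm (\<eta> - q \<tau>))\<^sup>2 = L * (norm \<eta>)\<^sup>2 - 2 * L * Re (\<Sum>i\<in>UNIV. cnj (\<eta> $ i) * q \<tau> $ i) + L * (norm (q \<tau>))\<^sup>2"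
      unfolding norm_diff_vec_expand by (simp only: distrib_left right_diff_distrib mult_ac)
    have ReG: "Re (G \<tau>) = Us - \<epsilon> * r\<^sup>2 / 2 - 2 * \<epsilon> * Re (cnj (x - c) * \<tau>) - 2 * L * Re (\<Sum>i\<in>UNIV. cnj (\<eta> $ i) * q \<tau> $ i)"
      unfolding G_def minus_complex.sel Re_complex_of_real Re_of_real_mult by simp
    have "Us + R (x, \<eta>) - R (x + \<tau>, \<eta> - q \<tau>) \<le> Re (G \<tau>)"
      unfolding ReG R_def fst_conv snd_conv 1 2 using qL by linarith
    then show "u ((\<phi> x + \<eta>) + \<tau> *s w) \<le> ereal (Re (G \<tau>))"
      using le by (cases "u ((\<phi> x + \<eta>) + \<tau> *s w)") auto
  qed
  moreover have "q 0 = 0" by (simp add: q_def)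
  ultimately have "Us \<le> Us - \<epsilon> * r\<^sup>2 / 2"
    by (simp add: Us G_def)
  moreover have "0 < \<epsilon> * r\<^sup>2" using \<epsilon>(1) r(1) by simp
  ultimately show False by linarith
qed

section \<open>The distance to the complement\<close>

text \<open>
  This is the domination property that makes \<open>- ln \<delta>\<close> subharmonic on the line
  through \<open>z\<close> in direction \<open>w\<close>. If it failed, holomorphic discs inside
  \<open>D\<close> could be pushed towards a single boundary point \<open>a\<close> with their
  boundaries staying in a compact subset of \<open>D\<close>, which the local function at
  \<open>a\<close> excludes by the maximum principle.
\<close>

lemma neg_ln_infdist_dominated:
  fixes D :: "(complex ^ 'n) set"
  assumes D: "open D" "D \<noteq> UNIV"
    and barrier: "\<And>a. a \<in> frontier D \<Longrightarrow>
           \<exists>U u. open U \<and> a \<in> U \<and> plurisubharmonic_on (D \<inter> U) u \<and>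
                 (u \<longlongrightarrow> \<infinity>) (at a within (D \<inter> U))"
    and r: "0 < r" "cball c r \<subseteq> {\<tau>. z + \<tau> *s w \<in> D}"
    and p: "p holomorphic_on UNIV"
    and bd: "\<And>\<tau>. \<tau> \<in> sphere c r \<Longrightarrow> - ln (infdist (z + \<tau> *s w) (- D)) \<le> Re (p \<tau>)"
  shows "- ln (infdist (z + c *s w) (- D)) \<le> Re (p c)"
proof (rule ccontr)
  define \<l> where "\<l> \<tau> = z + \<tau> *s w" for \<tau>
  define d where "d \<tau> = infdist (\<l> \<tau>) (- D)" for \<tau>
  define f where "f \<tau> = - ln (d \<tau>)" for \<tau>
  assume "\<not> - ln (infdist (z + c *s w) (- D)) \<le> Re (p c)"
  then have m: "f c - Re (p c) > 0" by (simp add: f_def d_def \<l>_def)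
  have X: "closed (- D)" "- D \<noteq> {}" using D by (auto simp: closed_def)
  have dpos: "d \<tau> > 0" if "\<tau> \<in> cball c r" for \<tau>
  proof -
    have "\<l> \<tau> \<notin> - D" using that r(2) by (auto simp: \<l>_def)
    then show ?thesis
      using in_closed_iff_infdist_zero[OF X, of "\<l> \<tau>"] infdist_nonneg[of "\<l> \<tau>" "- D"] by (auto simp: d_def less_le)
  qed
  have inD: "y \<in> D" if "dist (\<l> \<tau>) y < d \<tau>" for y \<tau>
    using infdist_le[of y "- D" "\<l> \<tau>"] that by (auto simp: d_def)
  have cont\<l>: "continuous_on A \<l>" for A
    unfolding \<l>_def by (intro continuous_intros)
  have contf: "continuous_on (cball c r) f"
    unfolding f_def d_def using dpos by (intro continuous_intros cont\<l>) (force simp: d_def)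
  have contp: "continuous_on A p" for A
    using p holomorphic_on_imp_continuous_on continuous_on_subset by blast
  \<comment> \<open>half of the excess at \<open>c\<close>: the quadratic term does not lift the boundary values above it, so
      the maximum is attained inside the disc\<close>
  define \<epsilon> where "\<epsilon> = (f c - Re (p c)) / (2 * r\<^sup>2)"
  have \<epsilon>: "\<epsilon> > 0" "\<epsilon> * r\<^sup>2 < f c - Re (p c)"
    using m r(1) by (auto simp: \<epsilon>_def)
  have "continuous_on (cball c r) (\<lambda>\<tau>. f \<tau> - Re (p \<tau>) + \<epsilon> * (norm (\<tau> - c))\<^sup>2)"
    by (intro continuous_intros contf contp)
  moreover have "cball c r \<noteq> {}" using r(1) by simp
  ultimately obtain x where x: "x \<in> cball c r"
    "\<And>\<tau>. \<tau> \<in> cball c r \<Longrightarrow> f \<tau> - Re (p \<tau>) + \<epsilon> * (norm (\<tau> - c))\<^sup>2 \<le> f x - Re (p x) + \<epsilon> * (norm (x - c))\<^sup>2"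
    using continuous_attains_sup[OF compact_cball, of c r] by blast
  have xb: "x \<in> ball c r"
  proof (rule ccontr)
    assume "x \<notin> ball c r"
    then have xs: "x \<in> sphere c r" using x(1) by auto
    then have "norm (x - c) = r" by (simp add: dist_norm norm_minus_commute)
    with bd[OF xs] x(2)[of c] \<epsilon>(2) r(1) show False by (simp add: f_def d_def \<l>_def)
  qed
  define M where "M = f x - Re (p x) + \<epsilon> * (norm (x - c))\<^sup>2"
  \<comment> \<open>expanding \<open>|\<tau> - c|^2\<close> about \<open>x\<close> leaves \<open>|\<tau> - x|^2\<close> and a harmonic part, which \<open>P\<close> absorbs\<close>
  define P where "P \<tau> = p \<tau> + of_real (M - \<epsilon> * (norm (x - c))\<^sup>2) - of_real (2 * \<epsilon>) * (cnj (x - c) * (\<tau> - x))" for \<tau>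
  have ReP: "Re (P \<tau>) = Re (p \<tau>) + (M - \<epsilon> * (norm (x - c))\<^sup>2) - 2 * \<epsilon> * Re (cnj (x - c) * (\<tau> - x))" for \<tau>
    unfolding P_def minus_complex.sel plus_complex.sel Re_complex_of_real Re_of_real_mult by simp
  have Px: "Re (P x) = f x" by (simp add: ReP M_def)
  have fP: "f \<tau> \<le> Re (P \<tau>) - \<epsilon> * (norm (\<tau> - x))\<^sup>2" if "\<tau> \<in> cball c r" for \<tau>
  proof -
    have "\<epsilon> * (norm (\<tau> - c))\<^sup>2 = \<epsilon> * ((norm (x - c))\<^sup>2 + 2 * Re (cnj (x - c) * (\<tau> - x)) + (norm (\<tau> - x))\<^sup>2)"
      using norm_add_cnj_expand[of "x - c" "\<tau> - x"] by simp
    also have "\<dots> = \<epsilon> * (norm (x - c))\<^sup>2 + 2 * \<epsilon> * Re (cnj (x - c) * (\<tau> - x)) + \<epsilon> * (norm (\<tau> - x))\<^sup>2"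
      by (simp add: algebra_simps)
    finally show ?thesis using x(2)[OF that] unfolding ReP M_def by linarith
  qed
  define g where "g \<tau> = exp (- P \<tau>)" for \<tau>
  have holg: "g holomorphic_on A" for A
    unfolding g_def P_def using holomorphic_on_subset[OF p subset_UNIV] by (intro holomorphic_intros)
  have normg: "norm (g \<tau>) = exp (- Re (P \<tau>))" for \<tau>
    by (simp add: g_def)
  have gx: "norm (g x) = d x"
    using dpos[OF x(1)] by (simp add: normg Px f_def)
  have gle: "norm (g \<tau>) \<le> d \<tau>" if "\<tau> \<in> cball c r" for \<tau>
  proof -
    have "norm (g \<tau>) \<le> exp (- f \<tau>)"
      unfolding normg using fP[OF that] \<epsilon>(1) by (simp add: add_increasing2 le_diff_eq) (smt (verit) mult_nonneg_nonneg zero_le_power2)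
    then show ?thesis using dpos[OF that] by (simp add: f_def)
  qed
  have glt: "norm (g \<tau>) < d \<tau>" if "\<tau> \<in> cball c r" "\<tau> \<noteq> x" for \<tau>
  proof -
    have "0 < \<epsilon> * (norm (\<tau> - x))\<^sup>2" using \<epsilon>(1) that(2) by simp
    then have "norm (g \<tau>) < exp (- f \<tau>)"
      unfolding normg using fP[OF that(1)] by simp
    then show ?thesis using dpos[OF that(1)] by (simp add: f_def)
  qed
  have g0: "g \<tau> \<noteq> 0" for \<tau> by (simp add: g_def)
  obtain a where a: "a \<in> - D" "d x = dist (\<l> x) a"
    using infdist_attains_inf[OF X, of "\<l> x"] unfolding d_def by blast
  define v where "v = inverse (g x) *s (a - \<l> x)"
  have normv: "norm v = 1"
    unfolding v_def norm_vector_scalar_mult norm_inverse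
    using a(2) gx dpos[OF x(1)] by (simp add: dist_norm norm_minus_commute)
  define \<phi> where "\<phi> t \<tau> = \<l> \<tau> + (of_real t * g \<tau>) *s v" for t :: real and \<tau>
  have \<phi>1: "\<phi> 1 x = a"
    using g0[of x] by (simp add: \<phi>_def v_def vector_smult_assoc)
  have dist\<phi>: "dist (\<l> \<tau>) (\<phi> t \<tau>) = \<bar>t\<bar> * norm (g \<tau>)" for t \<tau>
    by (simp add: \<phi>_def dist_norm norm_vector_scalar_mult normv norm_mult)
  have \<phi>D: "\<phi> t \<tau> \<in> D" if "\<tau> \<in> cball c r" "0 \<le> t" "t \<le> 1" "t < 1 \<or> \<tau> \<noteq> x" for t \<tau>
  proof (rule inD[of \<tau>])
    show "dist (\<l> \<tau>) (\<phi> t \<tau>) < d \<tau>"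
    proof (cases "t < 1")
      case True
      have "t * norm (g \<tau>) < 1 * norm (g \<tau>)"
        using True g0[of \<tau>] by (intro mult_strict_right_mono) auto
      then show ?thesis using gle[OF that(1)] that(2) by (simp add: dist\<phi>)
    next
      case False
      then show ?thesis using glt[OF that(1)] that by (simp add: dist\<phi>)
    qed
  qed
  have cont\<phi>: "continuous_on A (\<lambda>y. \<phi> (fst y) (snd y))" for A
    unfolding \<phi>_def
    by (intro continuous_intros continuous_on_compose2[OF cont\<l>[of UNIV]]
        continuous_on_compose2[OF holomorphic_on_imp_continuous_on[OF holg[of UNIV]]]) auto
  have lim: "((\<lambda>t. \<phi> t x) \<longlongrightarrow> a) (at_left 1)"
  proof -
    have "continuous_on UNIV (\<lambda>t. \<phi> t x)"
      by (rule continuous_on_compose2[OF cont\<phi>[of UNIV], of UNIV "\<lambda>t. (t, x)", simplified])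
        (intro continuous_intros)
    then have "((\<lambda>t. \<phi> t x) \<longlongrightarrow> \<phi> 1 x) (at 1)"
      by (simp add: continuous_on_def)
    then show ?thesis unfolding \<phi>1 by (rule filterlim_mono) (auto intro: at_le)
  qed
  have evt: "\<forall>\<^sub>F t in at_left (1::real). t1 \<le> t \<and> t < 1" if "t1 < 1" for t1
    using eventually_at_left[OF that] that by (auto intro!: exI[of _ t1])
  have "a \<in> closure D"
  proof (rule Lim_in_closed_set[OF closed_closure _ _ lim])
    show "\<forall>\<^sub>F t in at_left 1. \<phi> t x \<in> closure D"
      using evt[of 0] closure_subset[of D] \<phi>D[OF x(1)] by (auto elim!: eventually_mono)
  qed simp
  then have "a \<in> frontier D"
    using a(1) D(1) by (simp add: frontier_def interior_open)
  then obtain U u where U: "open U" "a \<in> U" "plurisubharmonic_on (D \<inter> U) u"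
    "(u \<longlongrightarrow> \<infinity>) (at a within (D \<inter> U))"
    using barrier by blast
  have "open ((\<lambda>y. \<phi> (fst y) (snd y)) -` U)"
    using U(1) cont\<phi> by (rule open_vimage)
  moreover have "(1, x) \<in> (\<lambda>y. \<phi> (fst y) (snd y)) -` U" by (simp add: \<phi>1 U(2))
  ultimately obtain A B where AB: "open A" "open B" "(1, x) \<in> A \<times> B"
    "A \<times> B \<subseteq> (\<lambda>y. \<phi> (fst y) (snd y)) -` U"
    by (rule open_prod_elim)
  have "open (B \<inter> ball c r)" "x \<in> B \<inter> ball c r" using AB xb by auto
  then obtain s where s: "s > 0" "cball x s \<subseteq> B \<inter> ball c r"
    using open_contains_cball by blast
  obtain h where h: "h > 0" "cball 1 h \<subseteq> A"
    using AB open_contains_cball by blast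
  \<comment> \<open>from \<open>t1\<close> on, the small discs \<open>\<phi> t ` cball x s\<close> lie in \<open>U\<close>\<close>
  define t1 where "t1 = max 0 (1 - h)"
  have t1: "0 \<le> t1" "t1 < 1" using h by (auto simp: t1_def)
  have tA: "t \<in> A" if "t1 \<le> t" "t \<le> 1" for t
    using h(2) that by (auto simp: t1_def dist_real_def subset_iff)
  have \<phi>DU: "\<phi> t \<tau> \<in> D \<inter> U" if "t1 \<le> t" "t \<le> 1" "\<tau> \<in> cball x s" "t < 1 \<or> \<tau> \<noteq> x" for t \<tau>
  proof
    have "\<tau> \<in> B" "\<tau> \<in> cball c r" using s(2) that(3) by auto
    then show "\<phi> t \<tau> \<in> D" using \<phi>D[of \<tau> t] that t1(1) by auto
    show "\<phi> t \<tau> \<in> U" using AB(4) tA[OF that(1,2)] \<open>\<tau> \<in> B\<close> by auto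
  qed
  have usc: "usc_on (D \<inter> U) u" and fin: "\<And>y. y \<in> D \<inter> U \<Longrightarrow> u y < \<infinity>"
    using U(3) by (auto simp: plurisubharmonic_on_def)
  \<comment> \<open>the boundaries of the discs, including the one for \<open>t = 1\<close>, which avoids \<open>a\<close>\<close>
  let ?L = "{t1..1} \<times> sphere x s"
  have sph: "\<phi> t \<tau> \<in> D \<inter> U" if "(t, \<tau>) \<in> ?L" for t \<tau>
    using that s(1) by (intro \<phi>DU) auto
  have L: "compact ?L" "?L \<noteq> {}"
    using t1 s(1) by (auto intro: compact_Times)
  have "usc_on ?L (\<lambda>y. u (\<phi> (fst y) (snd y)))"
    using sph by (intro usc_on_compose[OF usc cont\<phi>]) auto
  then obtain y0 where y0: "y0 \<in> ?L" "\<And>y. y \<in> ?L \<Longrightarrow> u (\<phi> (fst y) (snd y)) \<le> u (\<phi> (fst y0) (snd y0))"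
    using usc_on_attains_sup[OF L] by blast
  have "u (\<phi> (fst y0) (snd y0)) < \<infinity>" using y0(1) sph by (intro fin) auto
  then obtain C where C: "u (\<phi> (fst y0) (snd y0)) \<le> ereal C"
    by (cases "u (\<phi> (fst y0) (snd y0))") auto
  have bound: "u (\<phi> t x) \<le> ereal C" if t: "t1 \<le> t" "t < 1" for t
  proof (rule plurisubharmonic_on_disc_max_principle[OF U(3) _ open_UNIV subset_UNIV s(1)])
    show "(\<lambda>\<tau>. \<phi> t \<tau> $ i) holomorphic_on UNIV" for i
      unfolding \<phi>_def \<l>_def using holg by (auto intro!: holomorphic_intros)
    show "\<phi> t ` cball x s \<subseteq> D \<inter> U"
      using \<phi>DU t by auto
    show "u (\<phi> t \<tau>) \<le> ereal C" if "\<tau> \<in> sphere x s" for \<tau>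
      using y0(2)[of "(t, \<tau>)"] that t C by auto
  qed
  have "filterlim (\<lambda>t. \<phi> t x) (at a within (D \<inter> U)) (at_left 1)"
    unfolding filterlim_at
  proof
    show "\<forall>\<^sub>F t in at_left 1. \<phi> t x \<in> D \<inter> U \<and> \<phi> t x \<noteq> a"
      using evt[OF t1(2)]
    proof eventually_elim
      case (elim t)
      then have "\<phi> t x \<in> D \<inter> U" using s(1) by (intro \<phi>DU) auto
      then show ?case using a(1) by auto
    qed
  qed (rule lim)
  moreover have "\<forall>\<^sub>F y in at a within (D \<inter> U). ereal C < u y"
    using U(4) by (auto simp: order_tendsto_iff)
  ultimately have "\<forall>\<^sub>F t in at_left 1. ereal C < u (\<phi> t x)"
    unfolding filterlim_iff by blast
  with evt[OF t1(2)] have "\<forall>\<^sub>F t in at_left (1::real). False"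
    by eventually_elim (use bound in \<open>auto dest: leD\<close>)
  then show False by simp
qed

section \<open>The exhaustion function\<close>

lemma plurisubharmonic_onI_Re_holomorphic:
  fixes f :: "complex ^ 'n \<Rightarrow> real"
  assumes D: "open D" and f: "continuous_on D f"
    and dom: "\<And>z w c r G. 0 < r \<Longrightarrow> cball c r \<subseteq> {\<tau>. z + \<tau> *s w \<in> D} \<Longrightarrow> G holomorphic_on UNIV \<Longrightarrow>
            (\<And>\<tau>. \<tau> \<in> sphere c r \<Longrightarrow> f (z + \<tau> *s w) \<le> Re (G \<tau>)) \<Longrightarrow> f (z + c *s w) \<le> Re (G c)"
  shows "plurisubharmonic_on D (\<lambda>z. ereal (f z))"
  unfolding plurisubharmonic_on_def
proof (intro conjI ballI allI)
  fix z w :: "complex ^ 'n"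
  have line: "continuous_on A (\<lambda>\<tau>. z + \<tau> *s w)" for A
    by (intro continuous_intros)
  have "open ((\<lambda>\<tau>. z + \<tau> *s w) -` D)"
    using D line by (rule open_vimage)
  then have "open {\<tau>. z + \<tau> *s w \<in> D}"
    by (simp add: vimage_def)
  then show "subharmonic_on {\<tau>. z + \<tau> *s w \<in> D} (\<lambda>\<tau>. ereal (f (z + \<tau> *s w)))"
  proof (rule subharmonic_onI_Re_holomorphic)
    show "continuous_on {\<tau>. z + \<tau> *s w \<in> D} (\<lambda>\<tau>. f (z + \<tau> *s w))"
      by (rule continuous_on_compose2[OF f line]) auto
  qed (rule dom)
qed (use D f in \<open>auto intro: usc_on_continuous\<close>)

text \<open>
  The norm is the supremum of the real linear functionals given by unit vectors. The one that
  attains the norm at the centre is the real part of a holomorphic function along the line, so the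
  mean value property applies to its difference to \<open>G\<close>.
\<close>

lemma norm_dominated:
  fixes z w :: "complex ^ 'n"
  assumes "0 < r" "G holomorphic_on UNIV"
    and bd: "\<And>\<tau>. \<tau> \<in> sphere c r \<Longrightarrow> norm (z + \<tau> *s w) \<le> Re (G \<tau>)"
  shows "norm (z + c *s w) \<le> Re (G c)"
proof -
  define e where "e = sgn (z + c *s w)"
  define H where "H \<tau> = (\<Sum>i\<in>UNIV. cnj (e $ i) * (z + \<tau> *s w) $ i) - G \<tau>" for \<tau>
  have ReH: "Re (H \<tau>) = e \<bullet> (z + \<tau> *s w) - Re (G \<tau>)" for \<tau>
    by (simp add: H_def inner_vec_def inner_complex_def)
  have holH: "H holomorphic_on UNIV"
    unfolding H_def using assms(2) by (auto intro!: holomorphic_intros)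
  have "Re (H c) \<le> 0"
  proof -
    have "circle_mean (\<lambda>\<tau>. ereal (Re (H \<tau>))) c r \<le> circle_mean (\<lambda>\<tau>. ereal (Re 0)) c r"
    proof (rule circle_mean_mono[OF assms(1)])
      fix \<tau> assume "\<tau> \<in> sphere c r"
      then have "norm (z + \<tau> *s w) \<le> Re (G \<tau>)" by (rule bd)
      moreover have "e \<bullet> (z + \<tau> *s w) \<le> norm e * norm (z + \<tau> *s w)" by (rule norm_cauchy_schwarz)
      moreover have "norm e * norm (z + \<tau> *s w) \<le> norm (z + \<tau> *s w)"
        by (intro mult_left_le_one_le) (auto simp: e_def norm_sgn)
      ultimately show "ereal (Re (H \<tau>)) \<le> ereal (Re 0)" by (simp add: ReH)
    qed
    then show ?thesis
      unfolding circle_mean_Re_holomorphic[OF assms(1) holH subset_UNIV]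
        circle_mean_Re_holomorphic[OF assms(1) holomorphic_on_const subset_UNIV] by simp
  qed
  moreover have "e \<bullet> (z + c *s w) = norm (z + c *s w)"
    by (cases "z + c *s w = 0")
      (simp_all add: e_def sgn_div_norm power2_norm_eq_inner[symmetric] power2_eq_square)
  ultimately show ?thesis by (simp add: ReH)
qed

theorem proposition3:
  fixes D :: "(complex ^ 'n) set"
  assumes "open D" and "connected D"
    and "\<And>a. a \<in> frontier D \<Longrightarrow>
           \<exists>U u. open U \<and> a \<in> U \<and> plurisubharmonic_on (D \<inter> U) u \<and>
                 (u \<longlongrightarrow> \<infinity>) (at a within (D \<inter> U))"
  shows "pseudoconvex D"
proof (cases "D = UNIV")
  case True
  have "plurisubharmonic_on D (\<lambda>z. ereal (norm z))"
  proof (rule plurisubharmonic_onI_Re_holomorphic[OF assms(1)])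
    show "norm (z + c *s w) \<le> Re (G c)"
      if "0 < r" "G holomorphic_on UNIV" "\<And>\<tau>. \<tau> \<in> sphere c r \<Longrightarrow> norm (z + \<tau> *s w) \<le> Re (G \<tau>)"
      for z w :: "complex ^ 'n" and c r G
      using that by (rule norm_dominated)
  qed (intro continuous_intros)
  moreover have "compact (closure {z\<in>D. norm z < c})" for c
    unfolding compact_closure bounded_iff by (auto intro!: exI[of _ c])
  ultimately show ?thesis
    unfolding pseudoconvex_def using True by (intro exI[of _ norm]) (auto intro!: continuous_intros)
next
  case False
  define \<delta> where "\<delta> z = infdist z (- D)" for z
  define u where "u z = max (- ln (\<delta> z)) (norm z)" for z
  have X: "closed (- D)" "- D \<noteq> {}" using assms(1) False by (auto simp: closed_def)
  have in_D_iff: "z \<in> D \<longleftrightarrow> 0 < \<delta> z" for z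
    using in_closed_iff_infdist_zero[OF X, of z] infdist_nonneg[of z "- D"] by (auto simp: \<delta>_def less_le)
  have cont\<delta>: "continuous_on A \<delta>" for A
    unfolding \<delta>_def by (intro continuous_intros)
  have contu: "continuous_on D u"
    unfolding u_def using in_D_iff by (intro continuous_intros cont\<delta>) (auto simp: less_le)
  have "plurisubharmonic_on D (\<lambda>z. ereal (u z))"
  proof (rule plurisubharmonic_onI_Re_holomorphic[OF assms(1) contu])
    fix z w :: "complex ^ 'n" and c r G
    assume r: "0 < r" "cball c r \<subseteq> {\<tau>. z + \<tau> *s w \<in> D}" and G: "G holomorphic_on UNIV"
      and bd: "\<And>\<tau>. \<tau> \<in> sphere c r \<Longrightarrow> u (z + \<tau> *s w) \<le> Re (G \<tau>)"
    have "- ln (\<delta> (z + c *s w)) \<le> Re (G c)"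
      unfolding \<delta>_def
      by (rule neg_ln_infdist_dominated[OF assms(1) False assms(3) r G]) (use bd in \<open>auto simp: u_def \<delta>_def\<close>)
    moreover have "norm (z + c *s w) \<le> Re (G c)"
      by (rule norm_dominated[OF r(1) G]) (use bd in \<open>auto simp: u_def\<close>)
    ultimately show "u (z + c *s w) \<le> Re (G c)" by (simp add: u_def)
  qed
  moreover have "compact (closure {z\<in>D. u z < c})" "closure {z\<in>D. u z < c} \<subseteq> D" for c
  proof -
    have "norm z \<le> c" if "u z < c" for z
      using that by (simp add: u_def)
    then show "compact (closure {z\<in>D. u z < c})"
      unfolding compact_closure bounded_iff by blast
    have "{z\<in>D. u z < c} \<subseteq> {z. exp (- c) \<le> \<delta> z}"
    proof
      fix z assume "z \<in> {z\<in>D. u z < c}"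
      then have "0 < \<delta> z" "- c < ln (\<delta> z)" by (auto simp: u_def in_D_iff)
      then show "z \<in> {z. exp (- c) \<le> \<delta> z}"
        by (simp add: less_imp_le flip: ln_ge_iff)
    qed
    moreover have "closed {z. exp (- c) \<le> \<delta> z}"
      by (intro closed_Collect_le continuous_on_const cont\<delta>)
    ultimately have "closure {z\<in>D. u z < c} \<subseteq> {z. exp (- c) \<le> \<delta> z}"
      by (rule closure_minimal)
    also have "\<dots> \<subseteq> D"
      unfolding in_D_iff subset_iff by (auto intro: less_le_trans[OF exp_gt_zero])
    finally show "closure {z\<in>D. u z < c} \<subseteq> D" .
  qed
  ultimately show ?thesis
    unfolding pseudoconvex_def using contu by blast
qed

end
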